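(* Let $q$ be a prime power, $n\ge1$, and let $M$ be chosen uniformly at random from $\mathrm{GL}(n,\mathbb{F}_q)$. Then for every integer $0\le h<n-1$ and every monic $f\in\mathbb{F}_q[T]$ of degree $n$, $$\left|\mathbb{P}_{M\in\mathrm{GL}(n,\mathbb{F}_q)}\big(\det(T-M)\in I(f;h)\big)-\frac{q^{h+1}}{q^n}\right|\le\frac{n-h}{q^n}.$$
   Context: For a monic polynomial $f\in\mathbb{F}_q[T]$ of degree $n$ and $0\le h\le n-1$, $I(f;h)=\{g\in\mathbb{F}_q[T] \text{ monic}: \deg(f-g)\le h\}$ (with $\deg 0=-\infty$). $\det(T-M)$ is the characteristic polynomial of $M$. *)

theory Defs
  imports "Jordan_Normal_Form.Char_Poly"
begin

definition GL_mat :: "nat \<Rightarrow> 'a :: field mat set" where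
  "GL_mat n = {M \<in> carrier_mat n n. det M \<noteq> 0}"

text \<open>The short interval I(f;h): monic g with deg(f - g) \<le> h, where deg 0 = -infinity.\<close>
definition short_interval :: "'a :: field poly \<Rightarrow> nat \<Rightarrow> 'a poly set" where
  "short_interval f h = {g. monic g \<and> (f - g = 0 \<or> degree (f - g) \<le> h)}"

end

(*
Count pairs (M, v) with v in F_q^n by the cyclic subspace W spanned by v, Mv, M^2 v, ...
If dim W = k, then (M, v) is GL_n-conjugate to (A, e_0) with A = (C_g, B; 0, D), where C_g is the
companion matrix of a monic g of degree k. Here g is unique, and the conjugating matrix is unique up to
invertible matrices (1, B; 0, D). Writing N_m(Y) for the number of m x m matrices with
characteristic polynomial in Y, this gives
  q^n N_n(X) / |GL_n| = sum over monic g of degree k <= n of N_(n-k)({d. g d in X}) / |GL_(n-k)|.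
Take X to be the members of I(f;h) with nonzero constant term. The right-hand side is the sum over j <= n
of the mean, over D in GL_j, of the number of multiples of det(T - D) in X. For j <= h this number
is (q - 1) q^(h-j), and these add up to q^(h+1) - 1; for each of the n - h values j > h it is 0 or 1.
*)

theory Submission
  imports Defs
begin

section \<open>Characteristic polynomials of block triangular matrices, and invertibility\<close>

lemma char_poly_four_block_mat_lower_left_zero:
  fixes A :: "'a :: idom mat"
  assumes A: "A \<in> carrier_mat n n" and B: "B \<in> carrier_mat n m" and D: "D \<in> carrier_mat m m"
  shows "char_poly (four_block_mat A B (0\<^sub>m m n) D) = char_poly A * char_poly D"
proof -
  have "char_poly_matrix (four_block_mat A B (0\<^sub>m m n) D) =
      four_block_mat (char_poly_matrix A) (map_mat (\<lambda>a. [:- a:]) B) (0\<^sub>m m n) (char_poly_matrix D)"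
    by (rule eq_matI) (insert A B D, auto simp: char_poly_matrix_def)
  then show ?thesis
    unfolding char_poly_def
    by (simp add: det_four_block_mat_lower_left_zero[OF char_poly_matrix_closed[OF A]
          map_carrier_mat[THEN iffD2, OF B] refl char_poly_matrix_closed[OF D]])
qed

text \<open>The constant coefficient vanishes iff 0 is an eigenvalue. So invertibility becomes a
  condition on the characteristic polynomial alone and can be absorbed into the set of admissible
  polynomials.\<close>

lemma GL_mat_iff_coeff_char_poly:
  assumes "M \<in> carrier_mat n n"
  shows "M \<in> GL_mat n \<longleftrightarrow> coeff (char_poly M) 0 \<noteq> 0"
proof -
  have "char_matrix M 0 = M"
    by (rule eq_matI) (insert assms, auto simp: char_matrix_def)
  then show ?thesis
    using eigenvalue_det[OF assms, of 0] eigenvalue_root_char_poly[OF assms, of 0] assms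
    by (auto simp: GL_mat_def poly_0_coeff_0)
qed

section \<open>Companion matrices\<close>

text \<open>For monic \<open>g\<close> this is multiplication by T on F[T]/(g) in the basis 1, T,
  T^2, ...; the relation given by \<open>g\<close> sits in the last column. Degree 0 gives the empty
  matrix.\<close>

definition companion_mat :: "'a :: comm_ring_1 poly \<Rightarrow> 'a mat" where
  "companion_mat g = mat (degree g) (degree g)
     (\<lambda>(i, j). if Suc j = degree g then - coeff g i else if i = Suc j then 1 else 0)"

lemma companion_mat_carrier [simp]: "companion_mat g \<in> carrier_mat (degree g) (degree g)"
  by (simp add: companion_mat_def)

lemma dim_companion_mat [simp]:
  "dim_row (companion_mat g) = degree g" "dim_col (companion_mat g) = degree g"
  by (simp_all add: companion_mat_def)

lemma companion_mat_mult_unit_vec: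
  assumes "Suc j < degree g"
  shows "companion_mat g *\<^sub>v unit_vec (degree g) j = unit_vec (degree g) (Suc j)"
  by (rule eq_vecI) (insert assms, auto simp: companion_mat_def)

lemma companion_mat_mult_last_unit_vec:
  assumes "Suc j = degree g"
  shows "companion_mat g *\<^sub>v unit_vec (degree g) j = vec (degree g) (\<lambda>i. - coeff g i)"
  by (rule eq_vecI) (insert assms, auto simp: companion_mat_def)

text \<open>\<open>pCons a g\<close> is a + T g, and its companion matrix extends that of
  \<open>g\<close> by a new first row and column. This minor drives the recursion for the
  characteristic polynomial.\<close>

lemma mat_delete_char_poly_companion:
  fixes g :: "'a :: idom poly"
  assumes "degree g > 0"
  shows "mat_delete (char_poly_matrix (companion_mat (pCons a g))) 0 0 = char_poly_matrix (companion_mat g)"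
  by (rule eq_matI)
    (insert assms, auto simp: mat_delete_def char_poly_matrix_def companion_mat_def coeff_pCons
      split: nat.splits)

text \<open>Without the top row the subdiagonal entries -1 move onto the diagonal, and without the
  last column nothing remains below them.\<close>

lemma det_mat_delete_char_poly_companion:
  fixes g :: "'a :: idom poly"
  assumes "degree g > 0"
  shows "det (mat_delete (char_poly_matrix (companion_mat (pCons a g))) 0 (degree g)) = (- 1) ^ degree g"
proof -
  let ?D = "mat_delete (char_poly_matrix (companion_mat (pCons a g))) 0 (degree g)"
  have D: "?D \<in> carrier_mat (degree g) (degree g)"
    using assms by (simp add: mat_delete_def char_poly_matrix_def companion_mat_def)
  have "upper_triangular ?D"
    using assms by (auto simp: upper_triangular_def mat_delete_def char_poly_matrix_def companion_mat_def)
  then have "det ?D = prod_list (diag_mat ?D)"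
    using D by (rule det_upper_triangular)
  also have "diag_mat ?D = replicate (degree g) (- 1)"
    using assms D
    by (intro nth_equalityI)
      (auto simp: diag_mat_def mat_delete_def char_poly_matrix_def companion_mat_def one_pCons)
  finally show ?thesis by simp
qed

text \<open>Induction by Laplace expansion along the top row, whose only nonzero entries are T in
  the first column and a in the last; the two terms add up to T g + a.\<close>

lemma char_poly_companion_mat:
  fixes g :: "'a :: idom poly"
  assumes "monic g"
  shows "char_poly (companion_mat g) = g"
  using assms
proof (induction g)
  case 0
  then show ?case by simp
next
  case (pCons a g)
  show ?case
  \<comment> \<open>For constant \<open>g\<close> the matrix has size 0 or 1, so the top row does
    not have two separate end entries.\<close>
  proof (cases "degree g = 0")
    case True
    then obtain b where b: "g = [:b:]" by (rule degree_eq_zeroE)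
    show ?thesis
    proof (cases "b = 0")
      case True
      then show ?thesis using pCons.prems b
        by (simp add: char_poly_def det_dim_zero companion_mat_def char_poly_matrix_def one_pCons)
    next
      case False
      then have "b = 1" using pCons.prems b by simp
      have "char_poly_matrix (companion_mat (pCons a g)) \<in> carrier_mat 1 1"
        using b \<open>b = 1\<close> by (simp add: companion_mat_def char_poly_matrix_def)
      then show ?thesis
        using b \<open>b = 1\<close> unfolding char_poly_def
        by (subst det_single) (auto simp: companion_mat_def char_poly_matrix_def)
    qed
  next
    case False
    then have g: "g \<noteq> 0" and deg: "degree g > 0" by auto
    let ?n = "degree g"
    let ?A = "char_poly_matrix (companion_mat (pCons a g))"
    have A: "?A \<in> carrier_mat (Suc ?n) (Suc ?n)"
      using g by (simp add: char_poly_matrix_def companion_mat_def)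
    have "det ?A = (\<Sum>j<Suc ?n. ?A $$ (0, j) * cofactor ?A 0 j)"
      by (rule laplace_expansion_row[OF A]) simp
    also have "\<dots> = (\<Sum>j\<in>{0, ?n}. ?A $$ (0, j) * cofactor ?A 0 j)"
      using g deg
      by (intro sum.mono_neutral_right) (auto simp: char_poly_matrix_def companion_mat_def)
    also have "\<dots> = [:0, 1:] * cofactor ?A 0 0 + [:a:] * cofactor ?A 0 ?n"
      using g deg by (simp add: char_poly_matrix_def companion_mat_def)
    also have "cofactor ?A 0 0 = g"
      using pCons.IH pCons.prems g mat_delete_char_poly_companion[OF deg, of a]
      by (simp add: cofactor_def char_poly_def)
    \<comment> \<open>The sign of the cofactor cancels the determinant (-1)^(degree g) of the
      minor.\<close>
    also have "cofactor ?A 0 ?n = 1"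
      using det_mat_delete_char_poly_companion[OF deg, of a]
      by (simp add: cofactor_def flip: power_mult_distrib)
    also have "[:0, 1:] * g + [:a:] * 1 = pCons a g"
      by simp
    finally show ?thesis by (simp add: char_poly_def)
  qed
qed

section \<open>Inverses and conjugation in the general linear group\<close>

text \<open>The adjugate formula makes the inverse an explicit function of the matrix; it is an
  inverse only when the determinant is nonzero.\<close>

definition gl_inv :: "'a :: field mat \<Rightarrow> 'a mat" where
  "gl_inv P = inverse (det P) \<cdot>\<^sub>m adj_mat P"

lemma GL_matD:
  assumes "P \<in> GL_mat n"
  shows "P \<in> carrier_mat n n" "det P \<noteq> 0"
  using assms by (auto simp: GL_mat_def)

lemma gl_inv:
  assumes "P \<in> GL_mat n"
  shows "gl_inv P \<in> carrier_mat n n" "P * gl_inv P = 1\<^sub>m n" "gl_inv P * P = 1\<^sub>m n"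
proof -
  note P = GL_matD[OF assms]
  note adj = adj_mat[OF P(1)]
  show "gl_inv P \<in> carrier_mat n n"
    using adj(1) by (simp add: gl_inv_def)
  show "P * gl_inv P = 1\<^sub>m n"
    using P(2) by (simp add: gl_inv_def mult_smult_distrib[OF P(1) adj(1)] adj(2))
      (rule eq_matI, auto)
  show "gl_inv P * P = 1\<^sub>m n"
    using P(2) by (simp add: gl_inv_def mult_smult_assoc_mat[OF adj(1) P(1)] adj(3))
      (rule eq_matI, auto)
qed

lemma GL_matI_right_inverse:
  assumes "A \<in> carrier_mat n n" "B \<in> carrier_mat n n" "A * B = 1\<^sub>m n"
  shows "A \<in> GL_mat n"
proof -
  have "det A * det B = 1"
    using det_mult[OF assms(1,2)] assms(3) by simp
  then show ?thesis using assms(1) by (auto simp: GL_mat_def)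
qed

lemma GL_mat_mult:
  assumes "A \<in> GL_mat n" "B \<in> GL_mat n"
  shows "A * B \<in> GL_mat n"
  using assms det_mult[of A n B] by (auto simp: GL_mat_def)

lemma one_mat_in_GL_mat [simp]: "1\<^sub>m n \<in> GL_mat n"
  by (simp add: GL_mat_def)

lemma gl_inv_in_GL_mat:
  assumes "P \<in> GL_mat n"
  shows "gl_inv P \<in> GL_mat n"
  using gl_inv[OF assms] GL_matD[OF assms] GL_matI_right_inverse by blast

lemma gl_inv_mult_cancel:
  assumes "P \<in> GL_mat n" "A \<in> carrier_mat n m"
  shows "gl_inv P * (P * A) = A" "P * (gl_inv P * A) = A"
  using gl_inv[OF assms(1)] GL_matD[OF assms(1)] assms(2)
  by (simp_all flip: assoc_mult_mat[where ?n\<^sub>1 = n and ?n\<^sub>2 = n and ?n\<^sub>3 = n and ?n\<^sub>4 = m])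

lemma gl_inv_mult_vec_cancel:
  assumes "P \<in> GL_mat n" "v \<in> carrier_vec n"
  shows "gl_inv P *\<^sub>v (P *\<^sub>v v) = v" "P *\<^sub>v (gl_inv P *\<^sub>v v) = v"
  using gl_inv[OF assms(1)] GL_matD[OF assms(1)] assms(2)
  by (simp_all flip: assoc_mult_mat_vec[where ?n\<^sub>1 = n and ?n\<^sub>2 = n and ?n\<^sub>3 = n])

lemma GL_mat_mult_vec_inj:
  assumes "P \<in> GL_mat n" "v \<in> carrier_vec n" "w \<in> carrier_vec n" "P *\<^sub>v v = P *\<^sub>v w"
  shows "v = w"
  using assms gl_inv_mult_vec_cancel(1) by metis

lemma char_poly_conj:
  assumes "P \<in> GL_mat n" "A \<in> carrier_mat n n"
  shows "char_poly (P * A * gl_inv P) = char_poly A"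
proof (rule char_poly_similar, unfold similar_mat_def similar_mat_wit_def Let_def, intro exI conjI)
  show "{P * A * gl_inv P, A, P, gl_inv P} \<subseteq>
      carrier_mat (dim_row (P * A * gl_inv P)) (dim_row (P * A * gl_inv P))"
    using assms gl_inv[OF assms(1)] GL_matD[OF assms(1)] by auto
qed (use assms gl_inv[OF assms(1)] GL_matD[OF assms(1)] in auto)

section \<open>Block upper triangular matrices with a prescribed upper left block\<close>

text \<open>The matrices with block form \<open>(C B; 0 D)\<close>.\<close>

definition block_upper :: "'a :: field mat \<Rightarrow> nat \<Rightarrow> 'a mat set" where
  "block_upper C m = {A \<in> carrier_mat (dim_row C + m) (dim_row C + m).
     \<forall>w\<in>carrier_vec (dim_row C). A *\<^sub>v (w @\<^sub>v 0\<^sub>v m) = (C *\<^sub>v w) @\<^sub>v 0\<^sub>v m}"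

lemma unit_vec_append_zero:
  assumes "j < k"
  shows "unit_vec k j @\<^sub>v 0\<^sub>v m = unit_vec (k + m) j"
  by (rule eq_vecI) (use assms in auto)

lemma mult_unit_vec:
  fixes A :: "'a :: semiring_1 mat"
  assumes "A \<in> carrier_mat n m" "j < m"
  shows "A *\<^sub>v unit_vec m j = col A j"
  by (rule eq_vecI) (use assms in auto)

lemma mult_append_zero:
  fixes A :: "'a :: field mat"
  assumes "A \<in> carrier_mat n (k + m)" "w \<in> carrier_vec k" "i < n"
  shows "(A *\<^sub>v (w @\<^sub>v 0\<^sub>v m)) $ i = (\<Sum>j<k. A $$ (i, j) * w $ j)"
proof -
  have "(A *\<^sub>v (w @\<^sub>v 0\<^sub>v m)) $ i = (\<Sum>j<k + m. A $$ (i, j) * (w @\<^sub>v 0\<^sub>v m) $ j)"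
    using assms by (auto simp: scalar_prod_def atLeast0LessThan intro!: sum.cong)
  also have "\<dots> = (\<Sum>j<k. A $$ (i, j) * (w @\<^sub>v 0\<^sub>v m) $ j)"
    using assms by (intro sum.mono_neutral_right) auto
  also have "\<dots> = (\<Sum>j<k. A $$ (i, j) * w $ j)"
    using assms by (intro sum.cong) auto
  finally show ?thesis .
qed

text \<open>The images of the first k unit vectors are the first k columns, and by linearity they
  settle the action on all of their span.\<close>

lemma block_upperI_cols:
  assumes C: "C \<in> carrier_mat k k" and A: "A \<in> carrier_mat (k + m) (k + m)"
    and cols: "\<And>j. j < k \<Longrightarrow> A *\<^sub>v unit_vec (k + m) j = (C *\<^sub>v unit_vec k j) @\<^sub>v 0\<^sub>v m"
  shows "A \<in> block_upper C m"
proof -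
  have ent: "A $$ (i, j) = (if i < k then C $$ (i, j) else 0)" if "i < k + m" "j < k" for i j
  proof -
    have "A $$ (i, j) = (A *\<^sub>v unit_vec (k + m) j) $ i"
      using A that by simp
    also have "\<dots> = (if i < k then C $$ (i, j) else 0)"
      using C that unfolding cols[OF that(2)] by simp
    finally show ?thesis .
  qed
  have "A *\<^sub>v (w @\<^sub>v 0\<^sub>v m) = (C *\<^sub>v w) @\<^sub>v 0\<^sub>v m" if w: "w \<in> carrier_vec k" for w
  proof (rule eq_vecI)
    fix i assume "i < dim_vec ((C *\<^sub>v w) @\<^sub>v 0\<^sub>v m)"
    then have i: "i < k + m" using C by simp
    have "(A *\<^sub>v (w @\<^sub>v 0\<^sub>v m)) $ i = (\<Sum>j<k. (if i < k then C $$ (i, j) else 0) * w $ j)"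
      unfolding mult_append_zero[OF A w i] using ent[OF i] by (intro sum.cong) auto
    also have "\<dots> = ((C *\<^sub>v w) @\<^sub>v 0\<^sub>v m) $ i"
      using C w i by (auto simp: scalar_prod_def atLeast0LessThan intro!: sum.cong)
    finally show "(A *\<^sub>v (w @\<^sub>v 0\<^sub>v m)) $ i = ((C *\<^sub>v w) @\<^sub>v 0\<^sub>v m) $ i" .
  qed (use A C in auto)
  then show ?thesis using A C by (auto simp: block_upper_def)
qed

text \<open>The definition by the action on vectors suits arguments about orbits; this description
  by blocks suits counting.\<close>

lemma block_upper_eq_image:
  assumes C: "C \<in> carrier_mat k k"
  shows "block_upper C m =
    (\<lambda>(B, D). four_block_mat C B (0\<^sub>m m k) D) ` (carrier_mat k m \<times> carrier_mat m m)"
proof (intro equalityI subsetI)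
  fix A assume A: "A \<in> block_upper C m"
  then have Ac: "A \<in> carrier_mat (k + m) (k + m)"
    using C by (auto simp: block_upper_def)
  have ent: "A $$ (i, j) = (if i < k then C $$ (i, j) else 0)" if "i < k + m" "j < k" for i j
  proof -
    have "A *\<^sub>v (unit_vec k j @\<^sub>v 0\<^sub>v m) = (C *\<^sub>v unit_vec k j) @\<^sub>v 0\<^sub>v m"
      using A C by (auto simp: block_upper_def)
    then have "A *\<^sub>v unit_vec (k + m) j = (C *\<^sub>v unit_vec k j) @\<^sub>v 0\<^sub>v m"
      by (simp only: unit_vec_append_zero[OF that(2)])
    then have "(A *\<^sub>v unit_vec (k + m) j) $ i = ((C *\<^sub>v unit_vec k j) @\<^sub>v 0\<^sub>v m) $ i" by simp
    then show ?thesis using Ac C that by simp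
  qed
  have "A = four_block_mat C (mat k m (\<lambda>(i, j). A $$ (i, j + k))) (0\<^sub>m m k)
      (mat m m (\<lambda>(i, j). A $$ (i + k, j + k)))"
    by (rule eq_matI) (use Ac C ent in auto)
  then show "A \<in> (\<lambda>(B, D). four_block_mat C B (0\<^sub>m m k) D) ` (carrier_mat k m \<times> carrier_mat m m)"
    by (auto intro!: image_eqI[where x = "(mat k m (\<lambda>(i, j). A $$ (i, j + k)), mat m m (\<lambda>(i, j). A $$ (i + k, j + k)))"])
next
  fix A assume "A \<in> (\<lambda>(B, D). four_block_mat C B (0\<^sub>m m k) D) ` (carrier_mat k m \<times> carrier_mat m m)"
  then obtain B D where BD: "B \<in> carrier_mat k m" "D \<in> carrier_mat m m"
    and A: "A = four_block_mat C B (0\<^sub>m m k) D" by auto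
  show "A \<in> block_upper C m"
  proof (rule block_upperI_cols[OF C])
    fix j assume j: "j < k"
    show "A *\<^sub>v unit_vec (k + m) j = (C *\<^sub>v unit_vec k j) @\<^sub>v 0\<^sub>v m"
      by (rule eq_vecI) (use A BD C j in auto)
  qed (use A BD C in auto)
qed

lemma inj_on_block_upper:
  assumes C: "C \<in> carrier_mat k k"
  shows "inj_on (\<lambda>(B, D). four_block_mat C B (0\<^sub>m m k) D) (carrier_mat k m \<times> carrier_mat m m)"
proof (rule inj_onI, clarify)
  fix B D B' D'
  assume BD: "B \<in> carrier_mat k m" "D \<in> carrier_mat m m" "B' \<in> carrier_mat k m" "D' \<in> carrier_mat m m"
    and eq: "four_block_mat C B (0\<^sub>m m k) D = four_block_mat C B' (0\<^sub>m m k) D'"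
  have ent: "four_block_mat C B (0\<^sub>m m k) D $$ (i, j) = four_block_mat C B' (0\<^sub>m m k) D' $$ (i, j)" for i j
    using eq by simp
  have "B $$ (i, j) = B' $$ (i, j)" if "i < k" "j < m" for i j
    using ent[of i "j + k"] BD C that by simp
  moreover have "D $$ (i, j) = D' $$ (i, j)" if "i < m" "j < m" for i j
    using ent[of "i + k" "j + k"] BD C that by simp
  ultimately show "B = B' \<and> D = D'" using BD by (auto intro!: eq_matI)
qed

text \<open>The block B does not enter the characteristic polynomial, so it ranges freely and only D
  is constrained.\<close>

lemma card_block_upper_char_poly:
  fixes C :: "'a :: field mat"
  assumes C: "C \<in> carrier_mat k k"
  shows "card {A \<in> block_upper C m. char_poly A \<in> X} =
    card (carrier_mat k m :: 'a mat set) * card {D \<in> carrier_mat m m. char_poly C * char_poly D \<in> X}"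
proof -
  let ?S = "carrier_mat k m \<times> {D \<in> carrier_mat m m. char_poly C * char_poly D \<in> X}"
  let ?f = "\<lambda>(B, D). four_block_mat C B (0\<^sub>m m k) D"
  have "{A \<in> block_upper C m. char_poly A \<in> X} = ?f ` ?S"
    unfolding block_upper_eq_image[OF C]
    by (auto simp: char_poly_four_block_mat_lower_left_zero[OF C])
  moreover have "inj_on ?f ?S"
    by (rule inj_on_subset[OF inj_on_block_upper[OF C]]) auto
  ultimately show ?thesis by (simp add: card_image card_cartesian_product)
qed

text \<open>The determinant of (1, B; 0, D) is that of D. These matrices are the pointwise
  stabiliser of the first k unit vectors and later measure the ambiguity of the conjugating
  matrix.\<close>

lemma card_block_upper_one_GL:
  "card (block_upper (1\<^sub>m k) m \<inter> GL_mat (k + m) :: 'a :: field mat set) =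
    card (carrier_mat k m :: 'a mat set) * card (GL_mat m :: 'a mat set)"
proof -
  let ?S = "carrier_mat k m \<times> GL_mat m :: ('a mat \<times> 'a mat) set"
  let ?f = "\<lambda>(B, D). four_block_mat (1\<^sub>m k) B (0\<^sub>m m k) D"
  have "?S = {x \<in> carrier_mat k m \<times> carrier_mat m m. ?f x \<in> GL_mat (k + m)}"
    by (auto simp: GL_mat_def det_four_block_mat_lower_left_zero[of _ k _ m])
  then have "block_upper (1\<^sub>m k) m \<inter> GL_mat (k + m) = ?f ` ?S"
    unfolding block_upper_eq_image[OF one_carrier_mat] by blast
  moreover have "inj_on ?f ?S"
    by (rule inj_on_subset[OF inj_on_block_upper[OF one_carrier_mat]]) (auto dest: GL_matD)
  ultimately show ?thesis by (simp add: card_image card_cartesian_product)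
qed

section \<open>Finiteness and cardinalities of vector and matrix sets\<close>

lemma card_carrier_vec: "card (carrier_vec n :: 'a :: finite vec set) = card (UNIV :: 'a set) ^ n"
proof -
  have "bij_betw (vec n) ({..<n} \<rightarrow>\<^sub>E UNIV) (carrier_vec n :: 'a vec set)"
  proof (rule bij_betw_imageI)
    show "inj_on (vec n) ({..<n} \<rightarrow>\<^sub>E UNIV :: (nat \<Rightarrow> 'a) set)"
    proof (rule inj_onI)
      fix f g :: "nat \<Rightarrow> 'a"
      assume "f \<in> {..<n} \<rightarrow>\<^sub>E UNIV" "g \<in> {..<n} \<rightarrow>\<^sub>E UNIV" "vec n f = vec n g"
      then show "f = g"
        by (intro PiE_ext) (auto simp: vec_eq_iff)
    qed
    show "vec n ` ({..<n} \<rightarrow>\<^sub>E UNIV) = (carrier_vec n :: 'a vec set)"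
    proof (intro equalityI subsetI)
      fix v :: "'a vec" assume "v \<in> vec n ` ({..<n} \<rightarrow>\<^sub>E UNIV)"
      then show "v \<in> carrier_vec n" by (elim imageE) simp
    next
      fix v :: "'a vec" assume "v \<in> carrier_vec n"
      then have "v = vec n (restrict (vec_index v) {..<n})" by (intro eq_vecI) auto
      then show "v \<in> vec n ` ({..<n} \<rightarrow>\<^sub>E UNIV)"
        by (rule image_eqI[where x = "restrict (vec_index v) {..<n}"]) (simp_all add: restrict_PiE_iff)
    qed
  qed
  then have "card (carrier_vec n :: 'a vec set) = card ({..<n} \<rightarrow>\<^sub>E (UNIV :: 'a set))"
    by (rule bij_betw_same_card[symmetric])
  also have "\<dots> = card (UNIV :: 'a set) ^ n"
    by (subst card_PiE) simp_all
  finally show ?thesis .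
qed

lemma finite_carrier_mat: "finite (carrier_mat n m :: 'a :: finite mat set)"
proof -
  have "A \<in> mat n m ` ({..<n} \<times> {..<m} \<rightarrow>\<^sub>E UNIV)" if "A \<in> carrier_mat n m" for A :: "'a mat"
  proof -
    have "A = mat n m (restrict (index_mat A) ({..<n} \<times> {..<m}))"
      using that by (intro eq_matI) auto
    then show ?thesis
      by (rule image_eqI[where x = "restrict (index_mat A) ({..<n} \<times> {..<m})"]) (simp_all add: restrict_PiE_iff)
  qed
  then have "carrier_mat n m \<subseteq> mat n m ` ({..<n} \<times> {..<m} \<rightarrow>\<^sub>E (UNIV :: 'a set))"
    by (rule subsetI)
  then show ?thesis
    by (rule finite_subset) (rule finite_imageI, rule finite_PiE, simp_all)
qed

lemma finite_GL_mat: "finite (GL_mat n :: 'a :: {finite, field} mat set)"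
  by (rule finite_subset[OF _ finite_carrier_mat[of n n]]) (auto simp: GL_mat_def)

lemma card_GL_mat_pos: "card (GL_mat n :: 'a :: {finite, field} mat set) > 0"
proof -
  have "GL_mat n \<noteq> ({} :: 'a mat set)"
    using one_mat_in_GL_mat by blast
  then show ?thesis
    using finite_GL_mat by (simp add: card_gt_0_iff)
qed

section \<open>Uniqueness of the cyclic normal form\<close>

text \<open>In other words, with k = \<open>degree g\<close> > 0, the orbit of e_0 under
  \<open>A\<close> runs through e_0, ..., e_(k-1) and then closes up by the relation that
  \<open>g\<close> expresses.\<close>

lemma block_upper_companion_mult:
  assumes A: "A \<in> block_upper (companion_mat g) m" and j: "j < degree g"
  shows "A *\<^sub>v unit_vec (degree g + m) j =
    (if Suc j = degree g then vec (degree g) (\<lambda>i. - coeff g i) @\<^sub>v 0\<^sub>v m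
     else unit_vec (degree g + m) (Suc j))"
proof -
  have "A *\<^sub>v (unit_vec (degree g) j @\<^sub>v 0\<^sub>v m) = (companion_mat g *\<^sub>v unit_vec (degree g) j) @\<^sub>v 0\<^sub>v m"
    using A by (auto simp: block_upper_def)
  then show ?thesis
    using j companion_mat_mult_unit_vec[of j g] companion_mat_mult_last_unit_vec[of j g]
    by (auto simp: unit_vec_append_zero)
qed

lemma block_upper_one_fix:
  assumes "Q \<in> block_upper (1\<^sub>m k) m" "w \<in> carrier_vec k"
  shows "Q *\<^sub>v (w @\<^sub>v 0\<^sub>v m) = w @\<^sub>v 0\<^sub>v m"
  using assms by (auto simp: block_upper_def)

text \<open>This is e_0 for k > 0 and the zero vector for k = 0, so the vector v = 0, whose cyclic
  subspace is trivial, needs no separate normal form.\<close>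

definition cyclic_vec :: "nat \<Rightarrow> nat \<Rightarrow> 'a :: field vec" where
  "cyclic_vec k m = unit_vec k 0 @\<^sub>v 0\<^sub>v m"

lemma cyclic_vec_carrier [simp]: "cyclic_vec k m \<in> carrier_vec (k + m)"
  by (simp add: cyclic_vec_def)

lemma cyclic_vec_0: "cyclic_vec 0 m = 0\<^sub>v m"
  by (rule eq_vecI) (auto simp: cyclic_vec_def)

lemma cyclic_vec_pos: "k > 0 \<Longrightarrow> cyclic_vec k m = unit_vec (k + m) 0"
  by (simp add: cyclic_vec_def unit_vec_append_zero)

text \<open>Both \<open>A\<close> and \<open>A'\<close> are in normal form with respect to the cyclic subspace of the
  distinguished vector, so an intertwiner \<open>Q\<close> that fixes this vector fixes its whole orbit.\<close>

lemma intertwiner_le: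
  fixes g g' :: "'a :: field poly"
  assumes g: "monic g" "degree g + m = n" and g': "monic g'" "degree g' + m' = n"
    and A: "A \<in> block_upper (companion_mat g) m" and A': "A' \<in> block_upper (companion_mat g') m'"
    and Q: "Q \<in> GL_mat n" and comm: "Q * A' = A * Q"
    and fix_vec: "Q *\<^sub>v cyclic_vec (degree g') m' = cyclic_vec (degree g) m"
    and le: "degree g \<le> degree g'"
  shows "g = g'" "Q \<in> block_upper (1\<^sub>m (degree g)) m"
proof -
  let ?k = "degree g" and ?k' = "degree g'"
  note Qc = GL_matD(1)[OF Q]
  have Ac: "A \<in> carrier_mat n n" "A' \<in> carrier_mat n n"
    using A A' g g' by (auto simp: block_upper_def)
  have step: "Q *\<^sub>v (A' *\<^sub>v v) = A *\<^sub>v (Q *\<^sub>v v)" if "v \<in> carrier_vec n" for v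
    using arg_cong[OF comm, of "\<lambda>B. B *\<^sub>v v"] Qc Ac that by simp
  have fix_unit: "Q *\<^sub>v unit_vec n j = unit_vec n j" if "j < ?k" for j
    using that
  proof (induction j)
    case 0
    then show ?case using fix_vec g g' le by (simp add: cyclic_vec_pos)
  next
    case (Suc j)
    have "A *\<^sub>v unit_vec n j = unit_vec n (Suc j)" "A' *\<^sub>v unit_vec n j = unit_vec n (Suc j)"
      using block_upper_companion_mult[OF A, of j] block_upper_companion_mult[OF A', of j] Suc.prems g g' le
      by auto
    then show ?case using step[of "unit_vec n j"] Suc by simp
  qed
  show Qb: "Q \<in> block_upper (1\<^sub>m ?k) m"
  proof (rule block_upperI_cols)
    show "Q *\<^sub>v unit_vec (?k + m) j = (1\<^sub>m ?k *\<^sub>v unit_vec ?k j) @\<^sub>v 0\<^sub>v m" if "j < ?k" for j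
      using fix_unit[OF that] that g by (simp add: unit_vec_append_zero)
  qed (use Qc g in auto)
  \<comment> \<open>The first step of the orbit that leaves the listed unit vectors: its image under
    \<open>Q\<close> is dictated by \<open>g\<close>.\<close>
  have last: "Q *\<^sub>v (A' *\<^sub>v unit_vec n (?k - 1)) = vec ?k (\<lambda>i. - coeff g i) @\<^sub>v 0\<^sub>v m" if "?k > 0"
    using step[of "unit_vec n (?k - 1)"] fix_unit[of "?k - 1"] that g
      block_upper_companion_mult[OF A, of "?k - 1"] by simp
  \<comment> \<open>If the degrees differed, \<open>A'\<close> would send e_(k-1) to the new vector
    e_k, while \<open>A\<close> sends it into the span of e_0, ..., e_(k-1). As \<open>Q\<close> is
    injective and fixes this span pointwise, e_k would lie in it. For k = 0 the contradiction is
    that \<open>Q\<close> kills e_0.\<close>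
  have "?k = ?k'"
  proof (rule ccontr)
    assume "?k \<noteq> ?k'"
    with le have lt: "?k < ?k'" by simp
    show False
    proof (cases "?k = 0")
      case True
      have "Q *\<^sub>v 0\<^sub>v n = 0\<^sub>v n"
        by (rule eq_vecI) (use Qc in auto)
      then have "Q *\<^sub>v unit_vec n 0 = Q *\<^sub>v 0\<^sub>v n"
        using fix_vec True lt g g' Qc by (simp add: cyclic_vec_pos cyclic_vec_0)
      then have "unit_vec n 0 = (0\<^sub>v n :: 'a vec)"
        using GL_mat_mult_vec_inj[OF Q] by simp
      then show False using lt g' by simp
    next
      case False
      let ?w = "vec ?k (\<lambda>i. - coeff g i) @\<^sub>v 0\<^sub>v m"
      have "A' *\<^sub>v unit_vec n (?k - 1) = unit_vec n ?k"
        using block_upper_companion_mult[OF A', of "?k - 1"] lt False g' by auto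
      then have "Q *\<^sub>v unit_vec n ?k = Q *\<^sub>v ?w"
        using last False block_upper_one_fix[OF Qb] by simp
      moreover have "?w \<in> carrier_vec n"
        by (rule carrier_vecI) (use g(2) in simp)
      ultimately have "unit_vec n ?k = ?w"
        by (intro GL_mat_mult_vec_inj[OF Q unit_vec_carrier])
      then have "unit_vec n ?k $ ?k = ?w $ ?k" by simp
      then show False using lt g g' by simp
    qed
  qed
  \<comment> \<open>With equal degrees both images of e_(k-1) lie in the span fixed by
    \<open>Q\<close>, so they coincide; their entries are the negated coefficients.\<close>
  moreover have "coeff g i = coeff g' i" if "i < ?k" for i
  proof -
    have "m = m'" using \<open>?k = ?k'\<close> g g' by simp
    have "A' *\<^sub>v unit_vec n (?k - 1) = vec ?k (\<lambda>i. - coeff g' i) @\<^sub>v 0\<^sub>v m"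
      using block_upper_companion_mult[OF A', of "?k - 1"] \<open>?k = ?k'\<close> \<open>m = m'\<close> that g' by simp
    then have "vec ?k (\<lambda>i. - coeff g' i) @\<^sub>v 0\<^sub>v m = vec ?k (\<lambda>i. - coeff g i) @\<^sub>v 0\<^sub>v m"
      using last that block_upper_one_fix[OF Qb] by simp
    then have "(vec ?k (\<lambda>i. - coeff g' i) @\<^sub>v 0\<^sub>v m) $ i = (vec ?k (\<lambda>i. - coeff g i) @\<^sub>v 0\<^sub>v m) $ i"
      by simp
    then show ?thesis using that by simp
  qed
  ultimately show "g = g'"
    using g(1) g'(1) by (intro poly_eqI) (metis le_degree linorder_neqE_nat not_less)
qed

text \<open>The inverse of \<open>Q\<close> intertwines in the opposite direction, so the roles of
  \<open>g\<close> and \<open>g'\<close> can be exchanged and the comparison of degrees is no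
  restriction.\<close>

lemma intertwiner:
  fixes g g' :: "'a :: field poly"
  assumes g: "monic g" "degree g + m = n" and g': "monic g'" "degree g' + m' = n"
    and A: "A \<in> block_upper (companion_mat g) m" and A': "A' \<in> block_upper (companion_mat g') m'"
    and Q: "Q \<in> GL_mat n" and comm: "Q * A' = A * Q"
    and fix_vec: "Q *\<^sub>v cyclic_vec (degree g') m' = cyclic_vec (degree g) m"
  shows "g = g'" "Q \<in> block_upper (1\<^sub>m (degree g)) m"
proof -
  note Qc = GL_matD(1)[OF Q] and Qi = gl_inv[OF Q]
  have Ac: "A \<in> carrier_mat n n" "A' \<in> carrier_mat n n"
    using A A' g g' by (auto simp: block_upper_def)
  have "gl_inv Q * A = gl_inv Q * (A * Q) * gl_inv Q"
    using Qc Qi Ac by (simp add: assoc_mult_mat[of _ n n _ n _ n])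
  also have "\<dots> = A' * gl_inv Q"
    using Ac by (simp add: gl_inv_mult_cancel[OF Q] flip: comm)
  finally have comm': "gl_inv Q * A = A' * gl_inv Q" .
  have fix_vec': "gl_inv Q *\<^sub>v cyclic_vec (degree g) m = cyclic_vec (degree g') m'"
    using gl_inv_mult_vec_cancel(1)[OF Q, of "cyclic_vec (degree g') m'"] fix_vec g'
    by (metis cyclic_vec_carrier)
  show "g = g'"
    using intertwiner_le(1)[OF g g' A A' Q comm fix_vec]
      intertwiner_le(1)[OF g' g A' A gl_inv_in_GL_mat[OF Q] comm' fix_vec']
    by (metis nat_le_linear)
  then show "Q \<in> block_upper (1\<^sub>m (degree g)) m"
    using intertwiner_le(2)[OF g g' A A' Q comm fix_vec] by simp
qed

section \<open>Conjugates of normal forms and the size of the fibres\<close>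

text \<open>Multiplying by \<open>gl_inv P0\<close> on the left and by \<open>P\<close> on the right
  turns equality of two conjugates into an intertwining relation for
  \<open>gl_inv P0 * P\<close>.\<close>

lemma conj_eq_iff:
  assumes P: "P \<in> GL_mat n" and P0: "P0 \<in> GL_mat n"
    and A: "A \<in> carrier_mat n n" and A0: "A0 \<in> carrier_mat n n"
  shows "P * A * gl_inv P = P0 * A0 * gl_inv P0 \<longleftrightarrow> gl_inv P0 * P * A = A0 * (gl_inv P0 * P)"
proof
  note c = GL_matD(1)[OF P] GL_matD(1)[OF P0] gl_inv[OF P] gl_inv[OF P0] A A0
  note assoc = assoc_mult_mat[of _ n n _ n _ n]
  show "gl_inv P0 * P * A = A0 * (gl_inv P0 * P)" if "P * A * gl_inv P = P0 * A0 * gl_inv P0"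
  proof -
    have "gl_inv P0 * P * A = gl_inv P0 * (P * A * gl_inv P) * P"
      using c by (simp add: assoc)
    also have "\<dots> = A0 * (gl_inv P0 * P)"
      unfolding that using c by (simp add: assoc gl_inv_mult_cancel[OF P0, where m = n])
    finally show ?thesis .
  qed
  show "P * A * gl_inv P = P0 * A0 * gl_inv P0" if "gl_inv P0 * P * A = A0 * (gl_inv P0 * P)"
  proof -
    have "P * A * gl_inv P = P0 * (gl_inv P0 * P * A) * gl_inv P"
      using c by (simp add: assoc gl_inv_mult_cancel[OF P0, where m = n])
    also have "\<dots> = P0 * A0 * gl_inv P0"
      unfolding that using c by (simp add: assoc)
    finally show ?thesis .
  qed
qed

text \<open>Moves a normal form together with its distinguished vector by the change of basis
  \<open>P\<close>; k is the dimension of the cyclic subspace and m its codimension.\<close>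

definition conj_pair :: "nat \<Rightarrow> nat \<Rightarrow> 'a :: field mat \<times> 'a mat \<Rightarrow> 'a mat \<times> 'a vec" where
  "conj_pair k m = (\<lambda>(P, A). (P * A * gl_inv P, P *\<^sub>v cyclic_vec k m))"

lemma conj_pair_eq_iff:
  assumes "P \<in> GL_mat n" "P0 \<in> GL_mat n" "A \<in> carrier_mat n n" "A0 \<in> carrier_mat n n"
    and "k + m = n" "k0 + m0 = n"
  shows "conj_pair k m (P, A) = conj_pair k0 m0 (P0, A0) \<longleftrightarrow>
    gl_inv P0 * P * A = A0 * (gl_inv P0 * P) \<and>
    gl_inv P0 * P *\<^sub>v cyclic_vec k m = cyclic_vec k0 m0"
proof -
  have c: "cyclic_vec k m \<in> carrier_vec n" "cyclic_vec k0 m0 \<in> carrier_vec n"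
    using cyclic_vec_carrier[of k m] cyclic_vec_carrier[of k0 m0] assms(5,6) by simp_all
  have "P *\<^sub>v cyclic_vec k m = P0 *\<^sub>v cyclic_vec k0 m0 \<longleftrightarrow>
      gl_inv P0 * P *\<^sub>v cyclic_vec k m = cyclic_vec k0 m0"
  proof -
    have assoc: "gl_inv P0 * P *\<^sub>v cyclic_vec k m = gl_inv P0 *\<^sub>v (P *\<^sub>v cyclic_vec k m)"
      by (rule assoc_mult_mat_vec[OF gl_inv(1)[OF assms(2)] GL_matD(1)[OF assms(1)] c(1)])
    have "P *\<^sub>v cyclic_vec k m \<in> carrier_vec n"
      by (rule mult_mat_vec_carrier[OF GL_matD(1)[OF assms(1)] c(1)])
    from gl_inv_mult_vec_cancel(2)[OF assms(2) this] gl_inv_mult_vec_cancel(1)[OF assms(2) c(2)]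
    show ?thesis unfolding assoc by auto
  qed
  then show ?thesis
    using conj_eq_iff[OF assms(1-4)] by (simp add: conj_pair_def)
qed

definition cyclic_data :: "nat \<Rightarrow> 'a :: field poly \<Rightarrow> 'a poly set \<Rightarrow> ('a mat \<times> 'a mat) set" where
  "cyclic_data m g X =
    GL_mat (degree g + m) \<times> {A \<in> block_upper (companion_mat g) m. char_poly A \<in> X}"

text \<open>A common image makes \<open>gl_inv P' * P\<close> an intertwiner of the two normal forms
  that matches their distinguished vectors. Hence distinct polynomials have disjoint sets of
  pairs.\<close>

lemma conj_pair_cyclic_data_unique:
  fixes g g' :: "'a :: field poly"
  assumes g: "monic g" "degree g + m = n" and g': "monic g'" "degree g' + m' = n"
    and "y \<in> cyclic_data m g X" "y' \<in> cyclic_data m' g' X'"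
    and eq: "conj_pair (degree g) m y = conj_pair (degree g') m' y'"
  shows "g = g'"
proof -
  obtain P A P' A' where y: "y = (P, A)" "y' = (P', A')" by (cases y, cases y')
  have A: "A \<in> block_upper (companion_mat g) m" "A' \<in> block_upper (companion_mat g') m'"
    and P: "P \<in> GL_mat n" "P' \<in> GL_mat n"
    using assms y by (auto simp: cyclic_data_def)
  have Ac: "A \<in> carrier_mat n n" "A' \<in> carrier_mat n n"
    using A g g' by (auto simp: block_upper_def)
  show ?thesis
    using intertwiner(1)[OF g' g A(2,1) GL_mat_mult[OF gl_inv_in_GL_mat[OF P(2)] P(1)]] eq
    unfolding y conj_pair_eq_iff[OF P Ac g(2) g'(2)] by simp
qed

text \<open>\<open>Q\<close> fixes every vector supported on the first k coordinates, and
  \<open>A\<close> keeps such vectors among themselves, so conjugation by \<open>Q\<close> does not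
  change the action there.\<close>

lemma block_upper_conj:
  assumes C: "C \<in> carrier_mat k k" and km: "k + m = n"
    and A: "A \<in> block_upper C m" and Q: "Q \<in> block_upper (1\<^sub>m k) m" "Q \<in> GL_mat n"
  shows "gl_inv Q * (A * Q) \<in> block_upper C m"
proof -
  note Qc = GL_matD(1)[OF Q(2)] and Qi = gl_inv[OF Q(2)]
  have Ac: "A \<in> carrier_mat n n" using A C km by (auto simp: block_upper_def)
  have "gl_inv Q * (A * Q) *\<^sub>v (w @\<^sub>v 0\<^sub>v m) = (C *\<^sub>v w) @\<^sub>v 0\<^sub>v m" if w: "w \<in> carrier_vec k" for w
  proof -
    have wc: "w @\<^sub>v 0\<^sub>v m \<in> carrier_vec n" "(C *\<^sub>v w) @\<^sub>v 0\<^sub>v m \<in> carrier_vec n"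
      using w C km by auto
    have "gl_inv Q * (A * Q) *\<^sub>v (w @\<^sub>v 0\<^sub>v m) = gl_inv Q *\<^sub>v (A *\<^sub>v (Q *\<^sub>v (w @\<^sub>v 0\<^sub>v m)))"
      using Qc Qi Ac wc by (simp add: assoc_mult_mat_vec[of _ n n _ n])
    also have "\<dots> = gl_inv Q *\<^sub>v ((C *\<^sub>v w) @\<^sub>v 0\<^sub>v m)"
      using A C w block_upper_one_fix[OF Q(1) w] by (simp add: block_upper_def)
    also have "\<dots> = gl_inv Q *\<^sub>v (Q *\<^sub>v ((C *\<^sub>v w) @\<^sub>v 0\<^sub>v m))"
      using block_upper_one_fix[OF Q(1), of "C *\<^sub>v w"] C w by simp
    also have "\<dots> = (C *\<^sub>v w) @\<^sub>v 0\<^sub>v m"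
      using gl_inv_mult_vec_cancel(1)[OF Q(2) wc(2)] .
    finally show ?thesis .
  qed
  then show ?thesis using Qc Qi Ac C km by (auto simp: block_upper_def)
qed

text \<open>The fibre through (P0, A0) is the orbit of the points (P0 Q, Q^(-1) A0 Q), where
  \<open>Q\<close> runs over the invertible matrices (1, B; 0, D); the first component recovers
  \<open>Q\<close>, so nothing is counted twice.\<close>

lemma card_conj_pair_fibre:
  fixes g :: "'a :: field poly"
  assumes g: "monic g" and x: "x \<in> cyclic_data m g X"
  shows "card {y \<in> cyclic_data m g X. conj_pair (degree g) m y = conj_pair (degree g) m x} =
    card (block_upper (1\<^sub>m (degree g)) m \<inter> GL_mat (degree g + m) :: 'a mat set)"
proof -
  let ?k = "degree g"
  define n where "n = ?k + m"
  let ?S = "block_upper (1\<^sub>m ?k) m \<inter> GL_mat n :: 'a mat set"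
  obtain P0 A0 where x0: "x = (P0, A0)" by (cases x)
  have P0: "P0 \<in> GL_mat n" and A0: "A0 \<in> block_upper (companion_mat g) m"
    and X: "char_poly A0 \<in> X"
    using x x0 by (auto simp: cyclic_data_def n_def)
  have A0c: "A0 \<in> carrier_mat n n" using A0 by (auto simp: block_upper_def n_def)
  let ?f = "\<lambda>Q. (P0 * Q, gl_inv Q * (A0 * Q))"
  have km: "?k + m = n" by (simp add: n_def)
  have "{y \<in> cyclic_data m g X. conj_pair ?k m y = conj_pair ?k m x} = ?f ` ?S"
  proof (intro equalityI subsetI)
    fix y assume y: "y \<in> {y \<in> cyclic_data m g X. conj_pair ?k m y = conj_pair ?k m x}"
    obtain P A where PA: "y = (P, A)" by (cases y)
    have P: "P \<in> GL_mat n" and A: "A \<in> block_upper (companion_mat g) m"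
      and eq: "conj_pair ?k m (P, A) = conj_pair ?k m (P0, A0)"
      using y PA x0 by (auto simp: cyclic_data_def n_def)
    have Ac: "A \<in> carrier_mat n n" using A by (auto simp: block_upper_def n_def)
    \<comment> \<open>The only candidate, as the first component must satisfy P = P0 Q; it
      intertwines \<open>A\<close> and \<open>A0\<close> and so lies in the stabiliser.\<close>
    let ?Q = "gl_inv P0 * P"
    have Q: "?Q \<in> GL_mat n" using P P0 by (simp add: GL_mat_mult gl_inv_in_GL_mat)
    have comm: "?Q * A = A0 * ?Q" and "?Q *\<^sub>v cyclic_vec ?k m = cyclic_vec ?k m"
      using eq unfolding conj_pair_eq_iff[OF P P0 Ac A0c km km] by auto
    then have "?Q \<in> block_upper (1\<^sub>m ?k) m"
      using intertwiner(2)[OF g km g km A0 A Q] by blast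
    moreover have "P0 * ?Q = P"
      using gl_inv_mult_cancel(2)[OF P0 GL_matD(1)[OF P]] .
    moreover have "gl_inv ?Q * (A0 * ?Q) = A"
      unfolding comm[symmetric] using gl_inv_mult_cancel(1)[OF Q Ac] .
    ultimately show "y \<in> ?f ` ?S" using Q PA
      by (intro image_eqI[where x = ?Q]) simp_all
  next
    fix y assume "y \<in> ?f ` ?S"
    then obtain Q where Qb: "Q \<in> block_upper (1\<^sub>m ?k) m" and Q: "Q \<in> GL_mat n"
      and y: "y = (P0 * Q, gl_inv Q * (A0 * Q))" by auto
    let ?A = "gl_inv Q * (A0 * Q)"
    note Qc = GL_matD(1)[OF Q]
    have A: "?A \<in> block_upper (companion_mat g) m"
      by (rule block_upper_conj[OF companion_mat_carrier km A0 Qb Q])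
    have Ac: "?A \<in> carrier_mat n n" using A by (auto simp: block_upper_def n_def)
    have P: "P0 * Q \<in> GL_mat n" by (rule GL_mat_mult[OF P0 Q])
    have inv: "gl_inv P0 * (P0 * Q) = Q"
      by (rule gl_inv_mult_cancel(1)[OF P0 Qc])
    have comm: "Q * ?A = A0 * Q"
      by (rule gl_inv_mult_cancel(2)[OF Q]) (use A0c Qc in auto)
    have "Q * ?A * gl_inv Q = A0"
      using comm gl_inv[OF Q] A0c Qc by (simp add: assoc_mult_mat[of A0 n n Q n _ n])
    then have "char_poly ?A \<in> X"
      using char_poly_conj[OF Q Ac] X by simp
    moreover have "conj_pair ?k m (P0 * Q, ?A) = conj_pair ?k m (P0, A0)"
      unfolding conj_pair_eq_iff[OF P P0 Ac A0c km km] inv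
      using comm block_upper_one_fix[OF Qb] by (simp add: cyclic_vec_def)
    ultimately show "y \<in> {y \<in> cyclic_data m g X. conj_pair ?k m y = conj_pair ?k m x}"
      using y x0 A P by (simp add: cyclic_data_def n_def)
  qed
  moreover have "inj_on ?f ?S"
    by (rule inj_onI) (metis IntD2 GL_matD(1) gl_inv_mult_cancel(1)[OF P0] prod.inject)
  ultimately show ?thesis by (simp add: card_image n_def)
qed

lemma card_eq_card_image_times_fibre:
  assumes "finite S" "\<And>x. x \<in> S \<Longrightarrow> card {y \<in> S. f y = f x} = c"
  shows "card S = card (f ` S) * c"
proof -
  have "card S = (\<Sum>x\<in>S. 1)"
    by simp
  also have "\<dots> = (\<Sum>y\<in>f ` S. \<Sum>x\<in>{x \<in> S. f x = y}. 1)"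
    by (rule sum.image_gen[OF assms(1)])
  also have "\<dots> = (\<Sum>y\<in>f ` S. c)"
    using assms(2) by (intro sum.cong) auto
  finally show ?thesis by simp
qed

lemma finite_block_upper:
  "finite (block_upper C m :: 'a :: {finite, field} mat set)"
  by (rule finite_subset[OF _ finite_carrier_mat]) (auto simp: block_upper_def)

text \<open>The domain of \<open>conj_pair\<close> and each of its fibres contain the same factor,
  the number of free blocks B; it is nonzero and cancels.\<close>

lemma card_cyclic_pairs:
  fixes g :: "'a :: {finite, field} poly"
  assumes g: "monic g"
  shows "card (conj_pair (degree g) m ` cyclic_data m g X) * card (GL_mat m :: 'a mat set) =
    card (GL_mat (degree g + m) :: 'a mat set) * card {D \<in> carrier_mat m m. g * char_poly D \<in> X}"
proof -
  let ?B = "carrier_mat (degree g) m :: 'a mat set"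
  have "?B \<noteq> {}"
    using zero_carrier_mat by blast
  then have B: "card ?B > 0"
    using finite_carrier_mat by (simp add: card_gt_0_iff)
  have fin: "finite (cyclic_data m g X)"
    unfolding cyclic_data_def
    by (intro finite_cartesian_product finite_GL_mat finite_subset[OF _ finite_block_upper]) auto
  have "card ?B * (card (GL_mat (degree g + m) :: 'a mat set) *
      card {D \<in> carrier_mat m m. g * char_poly D \<in> X}) = card (cyclic_data m g X)"
    by (simp add: cyclic_data_def card_cartesian_product
        card_block_upper_char_poly[OF companion_mat_carrier] char_poly_companion_mat[OF g])
  also have "\<dots> = card (conj_pair (degree g) m ` cyclic_data m g X) *
      card (block_upper (1\<^sub>m (degree g)) m \<inter> GL_mat (degree g + m) :: 'a mat set)"
    by (rule card_eq_card_image_times_fibre[OF fin card_conj_pair_fibre[OF g]])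
  also have "\<dots> = card ?B * (card (conj_pair (degree g) m ` cyclic_data m g X) *
      card (GL_mat m :: 'a mat set))"
    by (simp add: card_block_upper_one_GL)
  finally show ?thesis
    unfolding nat_mult_eq_cancel1[OF B] by (rule sym)
qed

section \<open>Existence of the cyclic normal form\<close>

lemma ex_monic_poly_coeffs:
  fixes a :: "nat \<Rightarrow> 'a :: comm_ring_1"
  shows "\<exists>g. monic g \<and> degree g = k \<and> (\<forall>i<k. coeff g i = a i)"
proof -
  define g where "g = monom 1 k + (\<Sum>i<k. monom (a i) i)"
  have coeff: "coeff g i = (if i = k then 1 else if i < k then a i else 0)" for i
    by (simp add: g_def coeff_sum)
  have "degree g = k"
    by (rule antisym) (auto simp: coeff intro: degree_le le_degree)
  then show ?thesis using coeff by (intro exI[of _ g]) simp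
qed

lemma col_replace_col:
  assumes "A \<in> carrier_mat n m" "v \<in> carrier_vec n" "i < m"
  shows "col (replace_col A v j) i = (if i = j then v else col A i)"
  by (rule eq_vecI) (use assms in \<open>auto simp: replace_col_def\<close>)

lemma col_swapcols:
  assumes "A \<in> carrier_mat n m" "i < m" "k < m" "l < m"
  shows "col (swapcols k l A) i = (if i = k then col A l else if i = l then col A k else col A i)"
  by (rule eq_vecI) (use assms in auto)

text \<open>Steinitz exchange for columns: by Cramer's rule, putting P w in place of column j
  multiplies the determinant by the nonzero entry w_j. A swap then brings it to position k, and as k
  \<le> j the earlier columns stay.\<close>

lemma GL_mat_insert_col:
  fixes P :: "'a :: field mat"
  assumes P: "P \<in> GL_mat n" and w: "w \<in> carrier_vec n" and j: "k \<le> j" "j < n" "w $ j \<noteq> 0"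
  shows "\<exists>P' \<in> GL_mat n. (\<forall>i<k. col P' i = col P i) \<and> col P' k = P *\<^sub>v w"
proof -
  note Pc = GL_matD[OF P]
  define R where "R = replace_col P (P *\<^sub>v w) j"
  have R: "R \<in> carrier_mat n n" using Pc by (simp add: R_def replace_col_def)
  have "det R = w $ j * det P"
    unfolding R_def by (rule cramer_lemma_mat[OF Pc(1) w j(2)])
  then have det: "det R \<noteq> 0" using j Pc by simp
  have Pw: "P *\<^sub>v w \<in> carrier_vec n"
    by (rule mult_mat_vec_carrier[OF Pc(1) w])
  have col: "col R i = (if i = j then P *\<^sub>v w else col P i)" if "i < n" for i
    unfolding R_def by (rule col_replace_col[OF Pc(1) Pw that])
  show ?thesis
  proof (cases "j = k")
    case True
    then show ?thesis using R det col j by (intro bexI[of _ R]) (auto simp: GL_mat_def)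
  next
    case False
    have "det (swapcols k j R) \<noteq> 0"
      using det_swapcols[of k n j R] False j R det by simp
    then have "swapcols k j R \<in> GL_mat n" using R by (simp add: GL_mat_def)
    moreover have "col (swapcols k j R) i = (if i = k then P *\<^sub>v w else col P i)" if "i \<le> k" for i
      using col_swapcols[OF R, of i k j] col False j that by auto
    ultimately show ?thesis by (intro bexI[of _ "swapcols k j R"]) auto
  qed
qed

text \<open>Take k maximal such that v, M v, ..., M^(k-1) v are the first columns of an invertible
  \<open>P\<close>. Then M^k v is a combination of these columns, which defines \<open>g\<close>,
  and P^(-1) M P has the required block form.\<close>

lemma conj_pair_cyclic_data_surj:
  fixes M :: "'a :: field mat"
  assumes M: "M \<in> carrier_mat n n" and v: "v \<in> carrier_vec n" and X: "char_poly M \<in> X"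
  shows "\<exists>g m y. monic g \<and> degree g + m = n \<and> y \<in> cyclic_data m g X \<and>
    conj_pair (degree g) m y = (M, v)"
proof -
  define it where "it = (\<lambda>i. ((\<lambda>x. M *\<^sub>v x) ^^ i) v)"
  have it_0: "it 0 = v" and it_Suc: "it (Suc i) = M *\<^sub>v it i" for i
    by (simp_all add: it_def)
  have it: "it i \<in> carrier_vec n" for i
    by (induction i) (simp_all add: it_0 it_Suc v mult_mat_vec_carrier[OF M])
  \<comment> \<open>Linear independence of the first k iterates, phrased as their completion to an
    invertible matrix.\<close>
  define Ext where "Ext = (\<lambda>k. k \<le> n \<and> (\<exists>P \<in> GL_mat n. \<forall>i<k. col P i = it i))"
  define k where "k = (GREATEST k. Ext k)"
  have "Ext 0" using one_mat_in_GL_mat unfolding Ext_def by blast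
  have bound: "\<forall>k. Ext k \<longrightarrow> k \<le> n" by (simp add: Ext_def)
  have "Ext k"
    unfolding k_def by (rule GreatestI_nat[of Ext, OF \<open>Ext 0\<close> bound[rule_format]])
  have max: "\<not> Ext (Suc k)"
    using Greatest_le_nat[of Ext "Suc k" n] bound unfolding k_def[symmetric] by auto
  obtain P where kn: "k \<le> n" and P: "P \<in> GL_mat n" and cols: "\<And>i. i < k \<Longrightarrow> col P i = it i"
    using \<open>Ext k\<close> by (auto simp: Ext_def)
  note Pc = GL_matD(1)[OF P] and Pi = gl_inv[OF P]
  define m where "m = n - k"
  have km: "k + m = n" using kn by (simp add: m_def)
  \<comment> \<open>The coordinates of M^k v with respect to the columns of
    \<open>P\<close>.\<close>
  define w where "w = gl_inv P *\<^sub>v it k"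
  have w: "w \<in> carrier_vec n"
    unfolding w_def by (rule mult_mat_vec_carrier[OF Pi(1) it])
  have Pw: "P *\<^sub>v w = it k"
    unfolding w_def by (rule gl_inv_mult_vec_cancel(2)[OF P it])
  \<comment> \<open>A nonzero coordinate beyond the first k would allow M^k v to be exchanged in as
    column k, against the maximality of k.\<close>
  have w0: "w $ j = 0" if j: "k \<le> j" "j < n" for j
  proof (rule ccontr)
    assume "w $ j \<noteq> 0"
    then obtain P' where P': "P' \<in> GL_mat n" "\<forall>i<k. col P' i = col P i" "col P' k = it k"
      using GL_mat_insert_col[OF P w j] Pw by auto
    have "col P' i = it i" if "i < Suc k" for i
      using P' cols that by (cases "i = k") auto
    then have "Ext (Suc k)" using P'(1) j unfolding Ext_def by auto
    with max show False by simp
  qed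
  \<comment> \<open>\<open>g\<close> is T^k minus the sum of the w_i T^i, the relation satisfied by
    v.\<close>
  obtain g where g: "monic g" "degree g = k" and gw: "\<And>i. i < k \<Longrightarrow> coeff g i = - w $ i"
    using ex_monic_poly_coeffs[of k "\<lambda>i. - w $ i"] by blast
  have w_eq: "w = vec k (\<lambda>i. - coeff g i) @\<^sub>v 0\<^sub>v m"
    by (rule eq_vecI) (use w km gw w0 in auto)
  define A where "A = gl_inv P * (M * P)"
  have A: "A \<in> carrier_mat n n" using Pi Pc M by (simp add: A_def)
  have col_unit: "P *\<^sub>v unit_vec n j = it j" if "j < k" for j
    using mult_unit_vec[OF Pc, of j] cols that kn by simp
  have "A \<in> block_upper (companion_mat g) m"
  proof (rule block_upperI_cols)
    show "companion_mat g \<in> carrier_mat k k" using companion_mat_carrier[of g] g by simp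
    show "A \<in> carrier_mat (k + m) (k + m)" using A km by simp
    fix j assume j: "j < k"
    have "A *\<^sub>v unit_vec n j = gl_inv P *\<^sub>v (M *\<^sub>v (P *\<^sub>v unit_vec n j))"
      using Pc Pi M by (simp add: A_def assoc_mult_mat_vec[of _ n n _ n])
    also have "\<dots> = gl_inv P *\<^sub>v it (Suc j)"
      by (simp add: col_unit[OF j] it_Suc)
    also have "\<dots> = (companion_mat g *\<^sub>v unit_vec k j) @\<^sub>v 0\<^sub>v m"
    proof (cases "Suc j = k")
      case True
      then show ?thesis
        using companion_mat_mult_last_unit_vec[of j g] g w_eq by (simp add: w_def)
    next
      case False
      with j have j': "Suc j < k" by simp
      then show ?thesis
        using companion_mat_mult_unit_vec[of j g] g gl_inv_mult_vec_cancel(1)[OF P, of "unit_vec n (Suc j)"]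
        by (simp add: unit_vec_append_zero km flip: col_unit)
    qed
    finally show "A *\<^sub>v unit_vec (k + m) j = (companion_mat g *\<^sub>v unit_vec k j) @\<^sub>v 0\<^sub>v m"
      using km by simp
  qed
  moreover have PA: "P * A * gl_inv P = M"
  proof -
    have "P * A = M * P"
      unfolding A_def by (rule gl_inv_mult_cancel(2)[OF P mult_carrier_mat[OF M Pc(1)]])
    then show ?thesis
      using Pi Pc M by (simp add: assoc_mult_mat[of M n n P n _ n])
  qed
  moreover have "char_poly A \<in> X"
    using char_poly_conj[OF P A] PA X by simp
  moreover have "P *\<^sub>v cyclic_vec k m = v"
  \<comment> \<open>For k = 0 all coordinates \<open>w\<close> of v itself vanish, so v is the zero
    vector, as is \<open>cyclic_vec 0 m\<close>.\<close>
  proof (cases "k = 0")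
    case True
    have "cyclic_vec k m = w"
      by (rule eq_vecI) (use w0 w km True in \<open>auto simp: cyclic_vec_def\<close>)
    then show ?thesis using Pw True it_0 by simp
  next
    case False
    then show ?thesis using col_unit[of 0] km it_0 by (simp add: cyclic_vec_pos)
  qed
  ultimately have "(P, A) \<in> cyclic_data m g X \<and> conj_pair (degree g) m (P, A) = (M, v)"
    using P g km by (simp add: cyclic_data_def conj_pair_def)
  then show ?thesis using g km by blast
qed

section \<open>Counting polynomials of bounded degree\<close>

text \<open>\<open>pCons\<close> splits off the constant coefficient; the tail is the case of an
  unrestricted constant coefficient, so the induction must leave \<open>S\<close> arbitrary.\<close>

lemma card_poly_degree_le_coeff_0:
  fixes S :: "'a :: {finite, zero} set"
  shows "card {p. degree p \<le> m \<and> coeff p 0 \<in> S} = card S * card (UNIV :: 'a set) ^ m"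
proof (induction m arbitrary: S)
  case 0
  have "{p. degree p \<le> 0 \<and> coeff p 0 \<in> S} = (\<lambda>c. [:c:]) ` S"
    by (auto elim!: degree_eq_zeroE)
  moreover have "inj_on (\<lambda>c. [:c:]) S"
    by (rule inj_onI) simp
  ultimately show ?case by (simp add: card_image)
next
  case (Suc m)
  let ?R = "{p :: 'a poly. degree p \<le> m \<and> coeff p 0 \<in> UNIV}"
  have "{p. degree p \<le> Suc m \<and> coeff p 0 \<in> S} = (\<lambda>(a, p). pCons a p) ` (S \<times> ?R)"
  proof (intro equalityI subsetI)
    fix p assume p: "p \<in> {p. degree p \<le> Suc m \<and> coeff p 0 \<in> S}"
    obtain a r where ar: "p = pCons a r" by (cases p)
    then have "(a, r) \<in> S \<times> ?R"
      using p by (cases "r = 0") auto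
    then show "p \<in> (\<lambda>(a, p). pCons a p) ` (S \<times> ?R)"
      using ar by (intro image_eqI[where x = "(a, r)"]) simp_all
  next
    fix p assume "p \<in> (\<lambda>(a, p). pCons a p) ` (S \<times> ?R)"
    then obtain a r where "p = pCons a r" "a \<in> S" "degree r \<le> m" by auto
    then show "p \<in> {p. degree p \<le> Suc m \<and> coeff p 0 \<in> S}"
      using degree_pCons_le[of a r] by simp
  qed
  moreover have "inj_on (\<lambda>(a, p). pCons a p) (S \<times> ?R)"
    by (rule inj_onI) auto
  ultimately show ?case
    by (simp only: card_image card_cartesian_product Suc.IH power_Suc)
qed

lemma finite_poly_degree_le: "finite {p :: 'a :: {finite, zero} poly. degree p \<le> m}"
proof (rule card_ge_0_finite)
  show "card {p :: 'a poly. degree p \<le> m} > 0"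
    using card_poly_degree_le_coeff_0[of m "UNIV :: 'a set"] by (simp add: finite_UNIV_card_ge_0)
qed

lemma finite_monic_degree_le: "finite {g :: 'a :: {finite, field} poly. monic g \<and> degree g \<le> n}"
  by (rule finite_subset[OF _ finite_poly_degree_le[of n]]) auto

section \<open>Double counting of pairs of a matrix and a vector\<close>

text \<open>Both sides are the number of pairs (M, v), divided by the order of GL_n. On the left v
  is free; on the right the pairs are sorted by the polynomial \<open>g\<close> of their cyclic
  subspace, of dimension k.\<close>

lemma cyclic_decomposition_count:
  fixes X :: "'a :: {finite, field} poly set"
  shows "real (card {M \<in> carrier_mat n n. char_poly M \<in> X}) * real (card (UNIV :: 'a set)) ^ n /
      real (card (GL_mat n :: 'a mat set)) =
    (\<Sum>k\<le>n. (\<Sum>g | monic g \<and> degree g = k.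
        real (card {D \<in> carrier_mat (n - k) (n - k). g * char_poly D \<in> X})) /
        real (card (GL_mat (n - k) :: 'a mat set)))"
proof -
  let ?G = "{g :: 'a poly. monic g \<and> degree g \<le> n}"
  let ?Y = "\<lambda>g. conj_pair (degree g) (n - degree g) ` cyclic_data (n - degree g) g X"
  let ?N = "\<lambda>g :: 'a poly. card {D \<in> carrier_mat (n - degree g) (n - degree g). g * char_poly D \<in> X}"
  let ?q = "card (UNIV :: 'a set)"
  \<comment> \<open>Existence of normal forms gives one inclusion; conjugation preserving the
    characteristic polynomial gives the other.\<close>
  have decomp: "{M \<in> carrier_mat n n. char_poly M \<in> X} \<times> carrier_vec n = (\<Union>g\<in>?G. ?Y g)"
  proof (intro equalityI subsetI)
    fix x :: "'a mat \<times> 'a vec"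
    assume "x \<in> {M \<in> carrier_mat n n. char_poly M \<in> X} \<times> carrier_vec n"
    then obtain M v where x: "x = (M, v)" and Mv: "M \<in> carrier_mat n n" "v \<in> carrier_vec n" "char_poly M \<in> X"
      by auto
    obtain g m y where g: "monic g" "degree g + m = n" and y: "y \<in> cyclic_data m g X"
      and eq: "conj_pair (degree g) m y = (M, v)"
      using conj_pair_cyclic_data_surj[OF Mv] by blast
    have "m = n - degree g" "degree g \<le> n" using g by auto
    then have "g \<in> ?G" "x \<in> ?Y g" using g y eq x by (auto intro!: rev_image_eqI[of y])
    then show "x \<in> (\<Union>g\<in>?G. ?Y g)" by blast
  next
    fix x assume "x \<in> (\<Union>g\<in>?G. ?Y g)"
    then obtain g y where g: "monic g" "degree g \<le> n" and y: "y \<in> cyclic_data (n - degree g) g X"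
      and x: "x = conj_pair (degree g) (n - degree g) y" by auto
    obtain P A where PA: "y = (P, A)" by (cases y)
    have P: "P \<in> GL_mat n" and A: "A \<in> carrier_mat n n" "char_poly A \<in> X"
      using y PA g by (auto simp: cyclic_data_def block_upper_def)
    have "P *\<^sub>v cyclic_vec (degree g) (n - degree g) \<in> carrier_vec n"
      using cyclic_vec_carrier[of "degree g" "n - degree g"] g(2)
      by (intro mult_mat_vec_carrier[OF GL_matD(1)[OF P]]) simp
    then show "x \<in> {M \<in> carrier_mat n n. char_poly M \<in> X} \<times> carrier_vec n"
      using x PA A char_poly_conj[OF P A(1)] GL_matD(1)[OF P] gl_inv(1)[OF P]
      by (simp add: conj_pair_def)
  qed
  have fin: "finite (?Y g)" for g
    unfolding cyclic_data_def
    by (intro finite_imageI finite_cartesian_product finite_GL_mat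
        finite_subset[OF _ finite_block_upper]) auto
  have disj: "?Y g \<inter> ?Y g' = {}" if g: "g \<in> ?G" "g' \<in> ?G" "g \<noteq> g'" for g g'
  proof (rule ccontr)
    assume "?Y g \<inter> ?Y g' \<noteq> {}"
    then obtain y y' where "y \<in> cyclic_data (n - degree g) g X" "y' \<in> cyclic_data (n - degree g') g' X"
      "conj_pair (degree g) (n - degree g) y = conj_pair (degree g') (n - degree g') y'" by blast
    from conj_pair_cyclic_data_unique[OF _ _ _ _ this, of n] g show False by simp
  qed
  have cardY: "real (card (?Y g)) = real (card (GL_mat n :: 'a mat set)) *
      (real (?N g) / real (card (GL_mat (n - degree g) :: 'a mat set)))" if "g \<in> ?G" for g
  proof -
    have "card (?Y g) * card (GL_mat (n - degree g) :: 'a mat set) = card (GL_mat n :: 'a mat set) * ?N g"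
      using card_cyclic_pairs[of g "n - degree g" X] that by simp
    then have "real (card (?Y g)) * real (card (GL_mat (n - degree g) :: 'a mat set)) =
        real (card (GL_mat n :: 'a mat set)) * real (?N g)"
      by (simp only: flip: of_nat_mult)
    then show ?thesis
      using card_GL_mat_pos[of "n - degree g", where 'a = 'a] by (simp add: field_simps)
  qed
  have "card {M \<in> carrier_mat n n. char_poly M \<in> X} * ?q ^ n = card (\<Union>g\<in>?G. ?Y g)"
    unfolding decomp[symmetric] by (simp add: card_cartesian_product card_carrier_vec)
  also have "\<dots> = (\<Sum>g\<in>?G. card (?Y g))"
    by (rule card_UN_disjoint) (use finite_monic_degree_le fin disj in blast)+
  finally have "real (card {M \<in> carrier_mat n n. char_poly M \<in> X} * ?q ^ n) =
      (\<Sum>g\<in>?G. real (card (?Y g)))"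
    by simp
  also have "\<dots> = real (card (GL_mat n :: 'a mat set)) *
      (\<Sum>g\<in>?G. real (?N g) / real (card (GL_mat (n - degree g) :: 'a mat set)))"
    unfolding sum_distrib_left by (rule sum.cong[OF refl cardY])
  finally have "real (card {M \<in> carrier_mat n n. char_poly M \<in> X}) * real ?q ^ n /
      real (card (GL_mat n :: 'a mat set)) =
      (\<Sum>g\<in>?G. real (?N g) / real (card (GL_mat (n - degree g) :: 'a mat set)))"
    using card_GL_mat_pos[of n, where 'a = 'a] by (simp add: field_simps)
  also have "\<dots> = (\<Sum>k\<le>n. \<Sum>g | g \<in> ?G \<and> degree g = k.
      real (?N g) / real (card (GL_mat (n - degree g) :: 'a mat set)))"
    by (rule sum.group[symmetric]) (use finite_monic_degree_le in auto)
  also have "\<dots> = (\<Sum>k\<le>n. (\<Sum>g | monic g \<and> degree g = k.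
        real (card {D \<in> carrier_mat (n - k) (n - k). g * char_poly D \<in> X})) /
        real (card (GL_mat (n - k) :: 'a mat set)))"
    unfolding sum_divide_distrib by (intro sum.cong) auto
  finally show ?thesis .
qed

section \<open>Multiples of a fixed polynomial in a short interval\<close>

text \<open>Divide f by d, with quotient g0. The remainder has degree at most h, so (g0 + e) d is
  close enough to f exactly when e d has degree at most h, and the constant term rules out one value
  of e(0).\<close>

lemma card_multiples_in_short_interval:
  fixes f d :: "'a :: {finite, field} poly"
  assumes f: "monic f" "degree f = n" "h < n" and d: "monic d" "coeff d 0 \<noteq> 0"
    and k: "degree d + k = n" and le: "degree d \<le> h"
  shows "card {g. (monic g \<and> degree g = k) \<and> g * d \<in> short_interval f h \<and> coeff (g * d) 0 \<noteq> 0} =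
    (card (UNIV :: 'a set) - 1) * card (UNIV :: 'a set) ^ (h - degree d)"
proof -
  let ?j = "degree d" and ?g0 = "f div d" and ?r = "f mod d"
  have d0: "d \<noteq> 0" using d by auto
  have r: "degree ?r \<le> h"
    using degree_mod_less'[of d f] d0 le by (cases "?r = 0") auto
  have f_eq: "?g0 * d = f - ?r" by (simp add: minus_mod_eq_div_mult)
  have deg_f: "degree (f - ?r) = n"
    using degree_add_eq_left[of "- ?r" f] f r by simp
  have "coeff (f - ?r) n = 1"
    using f r coeff_eq_0[of ?r n] by simp
  then have "lead_coeff (?g0 * d) = 1" by (simp only: f_eq deg_f)
  then have g0m: "monic ?g0" using d by (simp add: lead_coeff_mult)
  then have g0: "?g0 \<noteq> 0" by auto
  have g0d: "degree ?g0 = k"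
    using deg_f k degree_mult_eq[OF g0 d0] by (simp add: f_eq)
  \<comment> \<open>Because h < n, every admissible correction e has smaller degree than g0, so g0 +
    e remains monic of degree k.\<close>
  have k_gt: "h - ?j < k" using f k le by simp
  let ?E = "{e. degree e \<le> h - ?j \<and> coeff e 0 \<in> - {- coeff ?g0 0}}"
  have key: "(f - (?g0 + e) * d = 0 \<or> degree (f - (?g0 + e) * d) \<le> h) \<longleftrightarrow> degree e \<le> h - ?j" for e
  proof -
    have eq: "f - (?g0 + e) * d = ?r - e * d"
      by (simp add: algebra_simps f_eq)
    have deg: "degree (e * d) = degree e + ?j" if "e \<noteq> 0"
      using that d0 by (rule degree_mult_eq)
    show ?thesis
    proof
      assume "degree e \<le> h - ?j"
      then have "degree (e * d) \<le> h"
        using deg le by (cases "e = 0") auto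
      then show "f - (?g0 + e) * d = 0 \<or> degree (f - (?g0 + e) * d) \<le> h"
        unfolding eq using r degree_diff_le by blast
    next
      assume "f - (?g0 + e) * d = 0 \<or> degree (f - (?g0 + e) * d) \<le> h"
      then have "degree (?r - e * d) \<le> h" unfolding eq by auto
      then have "degree (?r - (?r - e * d)) \<le> h"
        using r degree_diff_le by blast
      then have "degree (e * d) \<le> h" by simp
      then show "degree e \<le> h - ?j"
        using deg by (cases "e = 0") auto
    qed
  qed
  have "{g. (monic g \<and> degree g = k) \<and> g * d \<in> short_interval f h \<and> coeff (g * d) 0 \<noteq> 0} =
      (\<lambda>e. ?g0 + e) ` ?E"
  proof (intro equalityI subsetI)
    fix g assume g: "g \<in> {g. (monic g \<and> degree g = k) \<and> g * d \<in> short_interval f h \<and> coeff (g * d) 0 \<noteq> 0}"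
    then have "degree (g - ?g0) \<le> h - ?j"
      using key[of "g - ?g0"] by (simp add: short_interval_def)
    moreover have "coeff (g - ?g0) 0 \<in> - {- coeff ?g0 0}"
      using g by (simp add: coeff_mult_0)
    ultimately show "g \<in> (\<lambda>e. ?g0 + e) ` ?E"
      by (intro image_eqI[where x = "g - ?g0"]) simp_all
  next
    fix g assume "g \<in> (\<lambda>e. ?g0 + e) ` ?E"
    then obtain e where g: "g = ?g0 + e" and e: "degree e \<le> h - ?j" "coeff e 0 \<noteq> - coeff ?g0 0"
      by auto
    have "degree e < degree ?g0" using e k_gt g0d by simp
    then have deg: "degree g = k" and lc: "monic g"
      using g g0m g0d by (simp_all add: degree_add_eq_left coeff_eq_0)
    have "coeff g 0 \<noteq> 0"
      using e(2) by (simp add: g add_eq_0_iff)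
    then have "coeff (g * d) 0 \<noteq> 0"
      using d by (simp add: coeff_mult_0)
    moreover have "monic (g * d)" using lc d by (simp add: lead_coeff_mult)
    moreover have "f - g * d = 0 \<or> degree (f - g * d) \<le> h"
      using key[of e] e unfolding g by blast
    ultimately show "g \<in> {g. (monic g \<and> degree g = k) \<and> g * d \<in> short_interval f h \<and> coeff (g * d) 0 \<noteq> 0}"
      using deg lc unfolding short_interval_def by blast
  qed
  moreover have "inj_on (\<lambda>e. ?g0 + e) ?E" by (rule inj_onI) simp
  ultimately show ?thesis
    by (simp only: card_image card_poly_degree_le_coeff_0) (simp add: Compl_eq_Diff_UNIV)
qed

text \<open>The difference of two such multiples is a multiple of \<open>d\<close> of degree at most
  h < \<open>degree d\<close>, hence zero.\<close>

lemma card_multiples_in_short_interval_le: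
  fixes f d :: "'a :: {finite, field} poly"
  assumes lt: "h < degree d"
  shows "card {g. (monic g \<and> degree g = k) \<and> g * d \<in> short_interval f h \<and> coeff (g * d) 0 \<noteq> 0} \<le> 1"
    (is "card ?S \<le> 1")
proof -
  have "finite ?S"
    by (rule finite_subset[OF _ finite_monic_degree_le[of k]]) auto
  moreover have "g = g'" if "g \<in> ?S" "g' \<in> ?S" for g g'
  proof (rule ccontr)
    assume "g \<noteq> g'"
    then have "degree ((g - g') * d) = degree (g - g') + degree d"
      using lt by (intro degree_mult_eq) auto
    moreover have "(g - g') * d = (f - g' * d) - (f - g * d)"
      by (simp add: algebra_simps)
    moreover have "degree (f - g' * d) \<le> h" "degree (f - g * d) \<le> h"
      using that by (auto simp: short_interval_def)
    then have "degree ((f - g' * d) - (f - g * d)) \<le> h"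
      by (rule degree_diff_le)
    ultimately show False using lt by simp
  qed
  ultimately show ?thesis
    using card_le_Suc0_iff_eq[of ?S] by auto
qed

section \<open>Evaluation of the sum and the error bound\<close>

theorem theorem1p8:
  fixes f :: "'a :: {finite, field} poly" and n h :: nat
  assumes "n \<ge> 1" and "h + 1 < n"
    and "monic f" and "degree f = n"
  shows "\<bar>real (card {M \<in> GL_mat n. char_poly M \<in> short_interval f h}) / real (card (GL_mat n :: 'a mat set))
          - real (card (UNIV :: 'a set)) ^ (h + 1) / real (card (UNIV :: 'a set)) ^ n\<bar>
         \<le> (real n - real h) / real (card (UNIV :: 'a set)) ^ n"
proof -
  \<comment> \<open>With the nonzero constant term built in, matrices with characteristic polynomial
    in \<open>X\<close> are automatically invertible.\<close>
  define X where "X = {p \<in> short_interval f h. coeff p 0 \<noteq> 0}"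
  define q where "q = card (UNIV :: 'a set)"
  define T where "T = (\<lambda>k. (\<Sum>g | monic g \<and> degree g = k.
      real (card {D \<in> carrier_mat (n - k) (n - k). g * char_poly D \<in> X})) /
      real (card (GL_mat (n - k) :: 'a mat set)))"
  define c where "c = (\<lambda>k d. card {g. (monic g \<and> degree g = k) \<and> g * d \<in> short_interval f h \<and> coeff (g * d) 0 \<noteq> 0})"
  have q: "q > 0" by (simp add: q_def finite_UNIV_card_ge_0)
  have h: "h < n" using assms by simp
  have "{M \<in> GL_mat n. char_poly M \<in> short_interval f h} = {M \<in> carrier_mat n n. char_poly M \<in> X}"
    unfolding X_def using GL_mat_iff_coeff_char_poly GL_matD(1) by blast
  then have main: "real (card {M \<in> GL_mat n. char_poly M \<in> short_interval f h}) * real q ^ n /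
      real (card (GL_mat n :: 'a mat set)) = (\<Sum>k\<le>n. T k)"
    unfolding T_def q_def by (simp only: cyclic_decomposition_count)
  \<comment> \<open>Exchanging the two summations turns \<open>T k\<close> into the mean over D in
    GL_(n-k) of the number of admissible cofactors g of degree k.\<close>
  have T_eq: "T k = (\<Sum>D\<in>GL_mat (n - k). real (c k (char_poly D))) / real (card (GL_mat (n - k) :: 'a mat set))"
    for k
  proof -
    let ?m = "n - k"
    have finA: "finite {g :: 'a poly. monic g \<and> degree g = k}"
      by (rule finite_subset[OF _ finite_monic_degree_le[of k]]) auto
    have "(\<Sum>g | monic g \<and> degree g = k. real (card {D \<in> carrier_mat ?m ?m. g * char_poly D \<in> X})) =
        (\<Sum>g | monic g \<and> degree g = k. \<Sum>D | D \<in> carrier_mat ?m ?m \<and> g * char_poly D \<in> X. 1)"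
      by simp
    also have "\<dots> = (\<Sum>D\<in>carrier_mat ?m ?m. \<Sum>g | g \<in> {g. monic g \<and> degree g = k} \<and> g * char_poly D \<in> X. 1)"
      by (rule sum.swap_restrict[OF finA finite_carrier_mat])
    also have "\<dots> = (\<Sum>D\<in>carrier_mat ?m ?m. real (c k (char_poly D)))"
      by (simp add: c_def X_def)
    \<comment> \<open>A singular D contributes nothing, since its characteristic polynomial, and so
      every multiple of it, has constant term 0.\<close>
    also have "\<dots> = (\<Sum>D\<in>GL_mat ?m. real (c k (char_poly D)))"
    proof (rule sum.mono_neutral_right[OF finite_carrier_mat])
      show "\<forall>D\<in>carrier_mat ?m ?m - GL_mat ?m. real (c k (char_poly D)) = 0"
      proof
        fix D :: "'a mat" assume "D \<in> carrier_mat ?m ?m - GL_mat ?m"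
        then have "coeff (char_poly D) 0 = 0"
          using GL_mat_iff_coeff_char_poly[of D ?m] by auto
        then show "real (c k (char_poly D)) = 0"
          by (simp add: c_def coeff_mult_0)
      qed
    qed (use GL_matD(1) in blast)
    finally show ?thesis by (simp add: T_def)
  qed
  have GL_pos: "real (card (GL_mat m :: 'a mat set)) > 0" for m
    using card_GL_mat_pos by simp
  \<comment> \<open>Here the count is the same for all D, so the mean equals it.\<close>
  have T_large: "T k = real ((q - 1) * q ^ (h - (n - k)))" if k: "k \<le> n" "n - k \<le> h" for k
  proof -
    have "real (c k (char_poly D)) = real ((q - 1) * q ^ (h - (n - k)))" if D: "D \<in> GL_mat (n - k)" for D :: "'a mat"
    proof -
      have deg: "degree (char_poly D) = n - k" and mon: "monic (char_poly D)"
        using degree_monic_char_poly[OF GL_matD(1)[OF D]] by auto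
      have "coeff (char_poly D) 0 \<noteq> 0"
        using GL_mat_iff_coeff_char_poly[OF GL_matD(1)[OF D]] D by simp
      from card_multiples_in_short_interval[OF assms(3,4) h mon this, of k] show ?thesis
        using k deg by (simp add: c_def q_def)
    qed
    then have "T k = (\<Sum>D\<in>(GL_mat (n - k) :: 'a mat set). real ((q - 1) * q ^ (h - (n - k)))) /
        real (card (GL_mat (n - k) :: 'a mat set))"
      unfolding T_eq by (simp cong: sum.cong)
    then show ?thesis using GL_pos[of "n - k"] by simp
  qed
  have T_small: "0 \<le> T k \<and> T k \<le> 1" if k: "h < n - k" for k
  proof -
    have "real (c k (char_poly D)) \<le> 1" if D: "D \<in> GL_mat (n - k)" for D :: "'a mat"
      using card_multiples_in_short_interval_le[of h "char_poly D" k f]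
        degree_monic_char_poly[OF GL_matD(1)[OF D]] k by (simp add: c_def)
    then have "(\<Sum>D\<in>GL_mat (n - k). real (c k (char_poly D))) \<le> (\<Sum>D\<in>(GL_mat (n - k) :: 'a mat set). 1)"
      by (rule sum_mono)
    then show ?thesis
      unfolding T_eq using GL_pos[of "n - k"] by (simp add: sum_nonneg)
  qed
  \<comment> \<open>The threshold n - k \<le> h becomes k \<ge> n - h, which leaves n - h terms
    without an exact value.\<close>
  have "(\<Sum>k\<le>n. T k) = (\<Sum>k<n - h. T k) + (\<Sum>k = n - h..n. T k)"
    by (subst sum.union_disjoint[symmetric]) (auto intro!: sum.cong)
  also have "(\<Sum>k = n - h..n. T k) = (\<Sum>k = n - h..n. real ((q - 1) * q ^ (h - (n - k))))"
    by (rule sum.cong) (use T_large h in auto)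
  \<comment> \<open>Substituting i = h - (n - k) = k - (n - h) yields a geometric sum.\<close>
  also have "\<dots> = (\<Sum>i<h + 1. real ((q - 1) * q ^ i))"
    by (rule sum.reindex_bij_witness[of _ "\<lambda>i. i + (n - h)" "\<lambda>k. k - (n - h)"])
      (use h in \<open>auto simp: ac_simps\<close>)
  also have "\<dots> = (real q - 1) * (\<Sum>i<h + 1. real q ^ i)"
    unfolding sum_distrib_left using q by (simp add: of_nat_diff)
  also have "\<dots> = real q ^ (h + 1) - 1"
    by (rule power_diff_1_eq[symmetric])
  finally have total: "(\<Sum>k\<le>n. T k) = (\<Sum>k<n - h. T k) + (real q ^ (h + 1) - 1)" .
  have "0 \<le> (\<Sum>k<n - h. T k)"
    by (rule sum_nonneg) (use T_small in auto)
  moreover have "(\<Sum>k<n - h. T k) \<le> (\<Sum>k<n - h. 1)"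
    by (rule sum_mono) (use T_small in auto)
  \<comment> \<open>The difference is the sum of the n - h small terms minus 1, so it lies between
    -1 and n - h - 1; as n - h \<ge> 1, its absolute value is at most n - h.\<close>
  ultimately have bound: "\<bar>(\<Sum>k\<le>n. T k) - real q ^ (h + 1)\<bar> \<le> real n - real h"
    using h unfolding total by (simp add: of_nat_diff)
  have "real (card {M \<in> GL_mat n. char_poly M \<in> short_interval f h}) / real (card (GL_mat n :: 'a mat set))
      - real q ^ (h + 1) / real q ^ n = ((\<Sum>k\<le>n. T k) - real q ^ (h + 1)) / real q ^ n"
    using q by (simp add: diff_divide_distrib flip: main)
  then show ?thesis
    using bound q by (simp add: abs_divide divide_right_mono flip: q_def)
qed

end
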